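(* Let $(r,\rho)\in\mathcal{NC}$. Then $(M_{r,\rho},\sigma_{r,\rho})$ is a transitive dynamical system.
   Context: $(r,\rho)\in\mathcal{NC}$ means: $r,\rho\in(0,\infty)$, $r<1$, $\rho>1$, and for all integers $k,\ell$, $r^k=\rho^\ell$ if and only if $k=\ell=0$. Put $L_{r,\rho}=\{(x,y)\in[0,1]^2 : y=rx\}\cup\{(x,y)\in[0,1]^2: y=\rho x\}$ and $$M_{r,\rho}=\Big\{(x_1,x_2,x_3,\ldots)\in\prod_{i=1}^\infty[0,1] : (x_i,x_{i+1})\in L_{r,\rho}\text{ for each } i\ge 1\Big\},$$ with the subspace topology of the Hilbert cube. The map $\sigma_{r,\rho}:M_{r,\rho}\to M_{r,\rho}$ is the shift $\sigma_{r,\rho}(x_1,x_2,x_3,\ldots)=(x_2,x_3,\ldots)$. A dynamical system $(X,f)$ (with $f:X\to X$ continuous) is transitive if for all non-empty open sets $U,V\subseteq X$ there is a non-negative integer $n$ with $f^n(U)\cap V\neq\emptyset$. (It is known from earlier work that $M_{r,\rho}$ is a Lelek fan, i.e. a smooth fan whose set of end-points is dense.) *)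

theory Defs
  imports "HOL-Analysis.Analysis"
begin

definition NC :: "(real \<times> real) set" where
  "NC = {(r, \<rho>). 0 < r \<and> 0 < \<rho> \<and> r < 1 \<and> \<rho> > 1 \<and>
          (\<forall>k l :: int. r powi k = \<rho> powi l \<longleftrightarrow> k = 0 \<and> l = 0)}"

definition L :: "real \<Rightarrow> real \<Rightarrow> (real \<times> real) set" where
  "L r \<rho> = {(x, y) \<in> {0..1} \<times> {0..1}. y = r * x} \<union>
           {(x, y) \<in> {0..1} \<times> {0..1}. y = \<rho> * x}"

text \<open>Sequences are indexed from 0, so \<open>x i\<close> is the coordinate usually written $x_{i+1}$.\<close>

definition hilbert_cube :: "(nat \<Rightarrow> real) topology" where
  "hilbert_cube = product_topology (\<lambda>_. top_of_set {0..1}) UNIV"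

definition M :: "real \<Rightarrow> real \<Rightarrow> (nat \<Rightarrow> real) set" where
  "M r \<rho> = {x \<in> (\<Pi>\<^sub>E i\<in>UNIV. {0..1}). \<forall>i. (x i, x (Suc i)) \<in> L r \<rho>}"

definition M_space :: "real \<Rightarrow> real \<Rightarrow> (nat \<Rightarrow> real) topology" where
  "M_space r \<rho> = subtopology hilbert_cube (M r \<rho>)"

text \<open>The shift is defined on all sequences. That it maps \<open>M r \<rho>\<close> into itself is part of
  \<open>dynamical_system (M_space r \<rho>) shift\<close>, since \<open>continuous_map\<close> includes the
  requirement that the topological space of the source is mapped into that of the target.\<close>

definition shift :: "(nat \<Rightarrow> real) \<Rightarrow> (nat \<Rightarrow> real)" where
  "shift x = (\<lambda>i. x (Suc i))"

definition dynamical_system :: "'a topology \<Rightarrow> ('a \<Rightarrow> 'a) \<Rightarrow> bool" where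
  "dynamical_system X f \<longleftrightarrow> continuous_map X X f"

definition transitive_system :: "'a topology \<Rightarrow> ('a \<Rightarrow> 'a) \<Rightarrow> bool" where
  "transitive_system X f \<longleftrightarrow> dynamical_system X f \<and>
     (\<forall>U V. openin X U \<and> U \<noteq> {} \<and> openin X V \<and> V \<noteq> {} \<longrightarrow>
        (\<exists>n :: nat. (f ^^ n) ` U \<inter> V \<noteq> {}))"

end

theory Submission
  imports Defs
begin

text \<open>Given basic open sets around points \<open>x\<close> and \<open>y\<close> of \<open>M r \<rho>\<close> with non-zero coordinates, follow
  \<open>x\<close> as long as the first open set demands, apply the slope \<open>r\<close> sufficiently often and then the
  slope \<open>\<rho>\<close>, so as to land on \<open>c * y 0\<close> for some \<open>c < 1\<close> close to 1, and from there on follow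
  \<open>c * y\<close>. Such landing points exist because \<open>ln r / ln \<rho>\<close> is irrational, and doing all
  the contractions before the expansions keeps the orbit inside \<open>[0, 1]\<close>.\<close>

lemma M_iff:
  "x \<in> M r \<rho> \<longleftrightarrow> (\<forall>i. 0 \<le> x i \<and> x i \<le> 1 \<and> (x (Suc i) = r * x i \<or> x (Suc i) = \<rho> * x i))"
  by (auto simp: M_def L_def PiE_def Pi_def)

lemma M_scale:
  assumes "x \<in> M r \<rho>" "0 \<le> c" "c \<le> 1"
  shows "(\<lambda>i. c * x i) \<in> M r \<rho>"
  unfolding M_iff
proof
  fix i
  have "0 \<le> x i" "x i \<le> 1" "x (Suc i) = r * x i \<or> x (Suc i) = \<rho> * x i"
    using assms(1) by (auto simp: M_iff)
  with assms(2,3) show "0 \<le> c * x i \<and> c * x i \<le> 1 \<and>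
      (c * x (Suc i) = r * (c * x i) \<or> c * x (Suc i) = \<rho> * (c * x i))"
    by (auto simp: mult_le_one)
qed

lemma M_geometric:
  assumes "0 \<le> r" "r \<le> 1"
  shows "(\<lambda>i. r ^ i) \<in> M r \<rho>"
  using assms by (simp add: M_iff power_le_one)

lemma M_pos:
  assumes "x \<in> M r \<rho>" "0 < r" "0 < \<rho>" "0 < x 0"
  shows "0 < x i"
proof (induction i)
  case (Suc i)
  then show ?case using assms(1-3) unfolding M_iff by (metis mult_pos_pos)
qed (use assms in simp)

lemma M_zero:
  assumes "x \<in> M r \<rho>" "x 0 = 0"
  shows "x i = 0"
proof (induction i)
  case (Suc i)
  then show ?case using assms(1) unfolding M_iff by (metis mult_zero_right)
qed (use assms in simp)

lemma M_concat:
  assumes "x \<in> M r \<rho>" "w \<in> M r \<rho>" "w 0 = x m"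
  shows "(\<lambda>i. if i < m then x i else w (i - m)) \<in> M r \<rho>"
  unfolding M_iff
proof
  fix i
  \<comment> \<open>The middle case is the junction: there \<open>w 0 = x m\<close> turns the move
    from \<open>x i\<close> to \<open>w 0\<close> into a move of \<open>x\<close>.\<close>
  consider "Suc i < m" | "Suc i = m" | "m \<le> i" by linarith
  then show "0 \<le> (if i < m then x i else w (i - m)) \<and> (if i < m then x i else w (i - m)) \<le> 1 \<and>
    ((if Suc i < m then x (Suc i) else w (Suc i - m)) = r * (if i < m then x i else w (i - m)) \<or>
     (if Suc i < m then x (Suc i) else w (Suc i - m)) = \<rho> * (if i < m then x i else w (i - m)))"
    using assms by cases (auto simp: M_iff Suc_diff_le)
qed

lemma funpow_shift: "(shift ^^ n) x = (\<lambda>i. x (i + n))"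
  by (induction n) (auto simp: shift_def)

lemma M_prepend:
  assumes "w \<in> M r \<rho>" "w 0 = r * u \<or> w 0 = \<rho> * u" "0 \<le> u" "u \<le> 1"
  shows "\<exists>z\<in>M r \<rho>. z 0 = u \<and> shift z = w"
proof
  show "case_nat u w \<in> M r \<rho>"
    using assms by (auto simp: M_iff split: nat.split)
qed (auto simp: shift_def)

text \<open>The orbit is built backwards from \<open>w\<close>: since multiplying by \<rho> does not
  decrease a nonnegative number, every earlier coordinate is bounded by \<open>w 0\<close>, hence by
  1.\<close>

lemma M_reach_expanding:
  assumes "w \<in> M r \<rho>" "w 0 = \<rho> ^ l * u" "0 \<le> u" "1 \<le> \<rho>"
  shows "\<exists>z\<in>M r \<rho>. z 0 = u \<and> (shift ^^ l) z = w"
  using assms(2,3)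
proof (induction l arbitrary: u)
  case 0
  then show ?case using assms(1) by auto
next
  case (Suc l)
  have "w 0 = \<rho> ^ l * (\<rho> * u)" "0 \<le> \<rho> * u"
    using Suc.prems assms(4) by (auto simp: mult_ac)
  from Suc.IH[OF this] obtain z where z: "z \<in> M r \<rho>" "z 0 = \<rho> * u" "(shift ^^ l) z = w"
    by blast
  have "u \<le> \<rho> * u" using Suc.prems(2) assms(4) by (simp add: mult_le_cancel_right1)
  also have "\<dots> \<le> 1" using z(1,2) by (metis M_iff)
  finally obtain z' where z': "z' \<in> M r \<rho>" "z' 0 = u" "shift z' = z"
    using M_prepend z(1,2) Suc.prems(2) by metis
  show ?case
    by (rule bexI[OF _ z'(1)]) (use z z' in \<open>simp add: funpow_Suc_right del: funpow.simps\<close>)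
qed

text \<open>The first \<open>k\<close> moves contract, so they cannot leave the unit interval; the
  remaining \<open>l\<close> moves expand towards \<open>w 0\<close>, which lies in it.\<close>

lemma M_reach:
  assumes w: "w \<in> M r \<rho>" "w 0 = \<rho> ^ l * (r ^ k * u)"
    and u: "0 \<le> u" "u \<le> 1" and r: "0 \<le> r" "r \<le> 1" and \<rho>: "1 \<le> \<rho>"
  shows "\<exists>z\<in>M r \<rho>. z 0 = u \<and> (shift ^^ (l + k)) z = w"
proof -
  obtain w' where w': "w' \<in> M r \<rho>" "w' 0 = r ^ k * u" "(shift ^^ l) w' = w"
    using M_reach_expanding[OF w] u r \<rho> by auto
  define z where "z = (\<lambda>i. if i < k then u * r ^ i else w' (i - k))"
  have "z \<in> M r \<rho>"
    unfolding z_def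
    by (rule M_concat[OF M_scale[OF M_geometric]]) (use w' u r in auto)
  moreover have "z 0 = u" using w' by (cases k) (auto simp: z_def)
  moreover have "(shift ^^ k) z = w'" by (auto simp: funpow_shift z_def)
  then have "(shift ^^ (l + k)) z = w" using w' by (simp add: funpow_add)
  ultimately show ?thesis by blast
qed

text \<open>A value p/q of this quotient would give \<open>r powi q = \<rho> powi (- p)\<close> with
  q nonzero.\<close>

lemma NC_irrational:
  assumes "(r, \<rho>) \<in> NC"
  shows "- ln r / ln \<rho> \<notin> \<rat>"
proof
  have r: "0 < r" "1 < \<rho>" and nc: "\<And>k l :: int. r powi k = \<rho> powi l \<Longrightarrow> k = 0"
    using assms by (auto simp: NC_def)
  assume "- ln r / ln \<rho> \<in> \<rat>"
  then obtain p q :: int where pq: "q \<noteq> 0" "- ln r / ln \<rho> = of_int p / of_int q"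
    by (metis Rats_cases' less_irrefl)
  then have "of_int q * ln r = of_int (- p) * ln \<rho>"
    using r by (simp add: field_simps)
  moreover have "ln (r powi q) = of_int q * ln r" "ln (\<rho> powi (- p)) = of_int (- p) * ln \<rho>"
    using r by (simp_all add: powr_real_of_int'[symmetric] ln_powr del: of_int_minus power_int_minus)
  ultimately have "ln (r powi q) = ln (\<rho> powi (- p))" by simp
  then have "r powi q = \<rho> powi (- p)"
    using r by (subst (asm) ln_inj_iff) auto
  with nc pq show False by blast
qed

text \<open>In logarithms to base \<rho> the factor r becomes a shift by an irrational -\<theta> and
  the factor \<rho> a shift by 1, so density of the fractional parts of the multiples of \<theta>
  applies. The remaining work is to make both exponents natural numbers.\<close>

lemma NC_dense:
  assumes nc: "(r, \<rho>) \<in> NC" and s: "0 < s" and ab: "0 < a" "a < b"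
  shows "\<exists>k l :: nat. a < \<rho> ^ l * (r ^ k * s) \<and> \<rho> ^ l * (r ^ k * s) < b"
proof -
  have r: "0 < r" "r < 1" and \<rho>: "1 < \<rho>" using nc by (auto simp: NC_def)
  \<comment> \<open>Contracting below \<open>a\<close> in advance makes the target window (A, B)
    positive, so that it can be reached with a nonnegative power of \<rho>.\<close>
  obtain K where K: "r ^ K < a / s"
    using real_arch_pow_inv[of "a / s" r] r s ab by auto
  define s' where "s' = r ^ K * s"
  have s': "0 < s'" "s' < a"
    using r s K by (auto simp: s'_def field_simps)
  define \<theta> where "\<theta> = - ln r / ln \<rho>"
  define A where "A = ln (a / s') / ln \<rho>"
  define B where "B = ln (b / s') / ln \<rho>"
  have ln\<rho>: "0 < ln \<rho>" using \<rho> by simp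
  have A: "0 < A" "A < B"
    using s' ab ln\<rho> by (auto simp: A_def B_def intro!: divide_strict_right_mono)
  have \<theta>: "0 < \<theta>" "\<theta> \<notin> \<rat>"
    using NC_irrational[OF nc] r ln\<rho> by (auto simp: \<theta>_def divide_neg_pos)
  \<comment> \<open>Half the length of the window keeps approximations of its midpoint inside it;
    the cap 1 yields h > -1 below.\<close>
  define e where "e = min 1 ((B - A) / 2)"
  have e: "0 < e" "e \<le> 1" "e \<le> (B - A) / 2" using A by (simp_all add: e_def min_def)
  obtain h k :: int where hk: "0 < k" "\<bar>of_int k * \<theta> - of_int h - (- ((A + B) / 2))\<bar> < e"
    using sequence_of_fractional_parts_is_dense[OF \<theta>(2) e(1)] by blast
  then have close: "of_int k * \<theta> - of_int h + (A + B) / 2 < e"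
      "of_int h - of_int k * \<theta> - (A + B) / 2 < e"
    by (simp_all add: abs_less_iff)
  have "e - (A + B) / 2 < 1" using e(2) A by (simp add: field_simps)
  also have "1 \<le> of_int k * \<theta> + 1" using hk(1) \<theta>(1) by simp
  finally have "(-1 :: real) < of_int h" using close(1) by linarith
  then have h: "0 \<le> h" by linarith
  define t where "t = \<rho> ^ nat h * (r ^ nat k * s')"
  have t: "0 < t" using r \<rho> s' by (simp add: t_def)
  have "ln t = of_int h * ln \<rho> + of_int k * ln r + ln s'"
    using r \<rho> s' h hk(1) by (simp add: t_def ln_mult ln_realpow)
  also have "\<dots> = (of_int h - of_int k * \<theta>) * ln \<rho> + ln s'"
    using ln\<rho> by (simp add: \<theta>_def field_simps)
  finally have lnt: "ln t = (of_int h - of_int k * \<theta>) * ln \<rho> + ln s'" .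
  have "A < of_int h - of_int k * \<theta>" "of_int h - of_int k * \<theta> < B"
    using close e(3) by (simp_all add: field_simps)
  then have "A * ln \<rho> < ln t - ln s'" "ln t - ln s' < B * ln \<rho>"
    using lnt ln\<rho> by simp_all
  then have "ln a < ln t" "ln t < ln b"
    using ln\<rho> s' ab by (simp_all add: A_def B_def ln_div)
  then have "a < t" "t < b" using t ab by auto
  moreover have "t = \<rho> ^ nat h * (r ^ (nat k + K) * s)"
    by (simp add: t_def s'_def power_add mult_ac)
  ultimately show ?thesis by metis
qed

lemma topspace_M_space: "topspace (M_space r \<rho>) = M r \<rho>"
  by (auto simp: M_space_def hilbert_cube_def M_def)

text \<open>A basic open box restricts only finitely many coordinates, and \<open>m\<close> bounds
  their indices. Exact agreement suffices because the orbit constructed later copies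
  \<open>x\<close> exactly.\<close>

lemma openin_M_space_cylinder:
  assumes "openin (M_space r \<rho>) U" "x \<in> U"
  shows "\<exists>m. \<forall>z\<in>M r \<rho>. (\<forall>i<m. z i = x i) \<longrightarrow> z \<in> U"
proof -
  obtain T where T: "openin hilbert_cube T" "U = T \<inter> M r \<rho>"
    using assms(1) by (auto simp: M_space_def openin_subtopology)
  obtain X where X: "finite {i. X i \<noteq> {0..1}}" "x \<in> Pi\<^sub>E UNIV X" "Pi\<^sub>E UNIV X \<subseteq> T"
    using T assms(2) by (auto simp: hilbert_cube_def openin_product_topology_alt)
  obtain m where m: "\<And>i. X i \<noteq> {0..1} \<Longrightarrow> i < m"
    using X(1) unfolding finite_nat_set_iff_bounded by blast
  have "z \<in> U" if z: "z \<in> M r \<rho>" "\<forall>i<m. z i = x i" for z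
  proof -
    have "z i \<in> X i" for i
    proof (cases "i < m")
      case True
      then show ?thesis using X(2) z(2) by auto
    next
      case False
      then have "X i = {0..1}" using m by blast
      then show ?thesis using z(1) by (auto simp: M_iff)
    qed
    then show ?thesis using X(3) T(2) z(1) by auto
  qed
  then show ?thesis by blast
qed

lemma continuous_map_M_scale:
  assumes "x \<in> M r \<rho>"
  shows "continuous_map (top_of_set {0..1}) (M_space r \<rho>) (\<lambda>c i. c * x i)"
  unfolding M_space_def
proof (rule continuous_map_into_subtopology)
  show "(\<lambda>c i. c * x i) \<in> topspace (top_of_set {0..1}) \<rightarrow> M r \<rho>"
    using M_scale[OF assms] by auto
  have "continuous_on {0..1} (\<lambda>c. c * x i)" "(\<lambda>c. c * x i) ` {0..1} \<subseteq> {0..1}" for i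
    using assms by (auto simp: M_iff mult_le_one intro!: continuous_intros)
  then show "continuous_map (top_of_set {0..1}) hilbert_cube (\<lambda>c i. c * x i)"
    by (auto simp: hilbert_cube_def continuous_map_componentwise_UNIV continuous_map_in_subtopology)
qed

text \<open>Scaling a fixed point is a continuous path in \<open>M r \<rho>\<close>, so the
  parameters that land in \<open>U\<close> form an open set. It is used at c = 1 to perturb the
  target and at c = 0 to leave the zero sequence.\<close>

lemma openin_M_space_scale:
  assumes "openin (M_space r \<rho>) U" "x \<in> M r \<rho>" "(\<lambda>i. c * x i) \<in> U" "c \<in> {0..1}"
  shows "\<exists>e>0. \<forall>d\<in>{0..1}. \<bar>d - c\<bar> < e \<longrightarrow> (\<lambda>i. d * x i) \<in> U"
proof -
  have "openin (top_of_set {0..1}) {d \<in> {0..1}. (\<lambda>i. d * x i) \<in> U}"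
    using openin_continuous_map_preimage[OF continuous_map_M_scale[OF assms(2)] assms(1)] by simp
  then show ?thesis
    using assms(3,4) unfolding openin_euclidean_subtopology_iff dist_real_def by blast
qed

text \<open>An orbit that starts at 0 stays there, so the construction has to start from points with
  a positive coordinate.\<close>

lemma openin_M_space_pos:
  assumes "openin (M_space r \<rho>) U" "U \<noteq> {}" "0 < r" "r < 1"
  shows "\<exists>x\<in>U. 0 < x 0"
proof -
  obtain x where x: "x \<in> U" "x \<in> M r \<rho>"
    using assms(1,2) openin_subset topspace_M_space by fastforce
  show ?thesis
  proof (cases "x 0 = 0")
    case True
    \<comment> \<open>The zero sequence is the end of the segment of multiples of the geometric
      sequence, whose small positive multiples therefore lie in \<open>U\<close>.\<close>
    then have "(\<lambda>i. 0 * r ^ i) = x" using M_zero[OF x(2)] by auto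
    then obtain e where e: "0 < e" "\<forall>d\<in>{0..1}. \<bar>d - 0\<bar> < e \<longrightarrow> (\<lambda>i. d * r ^ i) \<in> U"
      using openin_M_space_scale[OF assms(1) M_geometric, of 0] x(1) assms(3,4) by auto
    let ?d = "min 1 (e / 2)"
    have "(\<lambda>i. ?d * r ^ i) \<in> U" using e by auto
    then show ?thesis using e(1) by (intro bexI) auto
  next
    case False
    with x show ?thesis by (metis M_iff less_eq_real_def)
  qed
qed

lemma continuous_map_shift: "continuous_map (M_space r \<rho>) (M_space r \<rho>) shift"
proof -
  have "continuous_map hilbert_cube (top_of_set {0..1}) (\<lambda>x. x (Suc i))" for i
    unfolding hilbert_cube_def by (rule continuous_map_product_projection) simp
  then have "continuous_map hilbert_cube hilbert_cube shift"
    unfolding shift_def by (subst (2) hilbert_cube_def) (simp add: continuous_map_componentwise_UNIV)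
  then show ?thesis
    unfolding M_space_def
    by (intro continuous_map_into_subtopology continuous_map_from_subtopology)
      (auto simp: shift_def M_iff)
qed

theorem theorem4p3:
  fixes r \<rho> :: real
  assumes "(r, \<rho>) \<in> NC"
  shows "transitive_system (M_space r \<rho>) shift"
proof -
  have r: "0 < r" "r < 1" and \<rho>: "1 < \<rho>" using assms by (auto simp: NC_def)
  have "\<exists>n. (shift ^^ n) ` U \<inter> V \<noteq> {}"
    if U: "openin (M_space r \<rho>) U" "U \<noteq> {}" and V: "openin (M_space r \<rho>) V" "V \<noteq> {}" for U V
  proof -
    obtain x where x: "x \<in> U" "0 < x 0" using openin_M_space_pos U r by blast
    obtain y where y: "y \<in> V" "0 < y 0" using openin_M_space_pos V r by blast
    have xM: "x \<in> M r \<rho>" and yM: "y \<in> M r \<rho>"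
      using x y U V openin_subset topspace_M_space by fastforce+
    obtain m where m: "\<And>z. \<lbrakk>z \<in> M r \<rho>; \<forall>i<m. z i = x i\<rbrakk> \<Longrightarrow> z \<in> U"
      using openin_M_space_cylinder[OF U(1) x(1)] by blast
    obtain e where e: "0 < e" "\<And>c. \<lbrakk>c \<in> {0..1}; \<bar>c - 1\<bar> < e\<rbrakk> \<Longrightarrow> (\<lambda>i. c * y i) \<in> V"
      using openin_M_space_scale[OF V(1) yM, of 1] y(1) by auto
    have xm: "0 < x m" "x m \<le> 1"
      using M_pos[OF xM] r \<rho> x(2) xM by (auto simp: M_iff)
    \<comment> \<open>Every c strictly between \<open>d\<close> and 1 is within \<open>e\<close> of
      1; the bound 1/2 keeps \<open>d * y 0\<close> positive, as \<open>NC_dense\<close>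
      requires.\<close>
    define d where "d = max (1/2) (1 - e)"
    have d: "0 < d" "d < 1" "1 - e \<le> d" using e(1) by (auto simp: d_def)
    obtain k l where kl: "d * y 0 < \<rho> ^ l * (r ^ k * x m)" "\<rho> ^ l * (r ^ k * x m) < y 0"
      using NC_dense[OF assms xm(1), of "d * y 0" "y 0"] d y(2) by auto
    \<comment> \<open>With this factor, \<open>c * y 0\<close> is exactly the landing point of the
      moves from \<open>x m\<close>.\<close>
    define c where "c = \<rho> ^ l * (r ^ k * x m) / y 0"
    have c: "d < c" "c < 1" using kl y(2) by (auto simp: c_def field_simps)
    let ?w = "\<lambda>i. c * y i"
    have w: "?w \<in> V" using c d by (intro e(2)) auto
    have "?w \<in> M r \<rho>" using c d by (intro M_scale[OF yM]) auto
    moreover have "?w 0 = \<rho> ^ l * (r ^ k * x m)" using y(2) by (simp add: c_def)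
    ultimately obtain v where v: "v \<in> M r \<rho>" "v 0 = x m" "(shift ^^ (l + k)) v = ?w"
      using M_reach[of ?w r \<rho> l k "x m"] xm r \<rho> by auto
    define z where "z = (\<lambda>i. if i < m then x i else v (i - m))"
    have "z \<in> U" unfolding z_def by (intro m M_concat[OF xM v(1,2)]) auto
    moreover have "(shift ^^ m) z = v" by (auto simp: funpow_shift z_def)
    then have "(shift ^^ (l + k + m)) z = ?w" using v(3) by (simp add: funpow_add)
    ultimately have "?w \<in> (shift ^^ (l + k + m)) ` U \<inter> V" using w by (metis IntI imageI)
    then show ?thesis by (metis emptyE)
  qed
  then show ?thesis
    using continuous_map_shift unfolding transitive_system_def dynamical_system_def by blast
qed

end
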